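(* Let $\mathcal{A}$ be a finite alphabet. If a nonempty set $X\subseteq\mathcal{A}^{\mathbb{N}}$ is weakly shift-stable, then $X$ has stable prefix entropy, and in addition $H_p(X)=H_{\mathrm{top}}(X)$. Consequently, for $n\ge1$ and nonempty weakly shift-stable sets $X_0,\dots,X_{n-1}\subseteq\mathcal{A}^{\mathbb{N}}$, the $n$-fold interleaving $X=X_0\circledast X_1\circledast\cdots\circledast X_{n-1}$ satisfies $$H_{\mathrm{top}}(X)=\frac1n\sum_{i=0}^{n-1}H_{\mathrm{top}}(X_i).$$
   Context: $\mathbb{N}=\{0,1,2,\dots\}$. The shift is $S(a_0a_1a_2\cdots)=a_1a_2a_3\cdots$. A set $X\subseteq\mathcal{A}^{\mathbb{N}}$ is weakly shift-stable if there are integers $k>j\ge0$ with $S^kX\subseteq S^jX$. The $n$-fold interleaving of sequences $\mathbf{x}_i=a_{i,0}a_{i,1}\cdots\in\mathcal{A}^{\mathbb{N}}$ ($0\le i\le n-1$) is $b_0b_1b_2\cdots$ with $b_{i+jn}=a_{i,j}$ ($0\le i\le n-1$, $j\ge0$); the $n$-fold interleaving $X_0\circledast\cdots\circledast X_{n-1}$ of sets is the set of all $n$-fold interleavings of $(\mathbf{x}_0,\dots,\mathbf{x}_{n-1})$ with $\mathbf{x}_i\in X_i$. $N_k(X)$ is the number of distinct blocks of $k$ consecutive symbols occurring (in any position) in words $\mathbf{x}\in X$, and the topological entropy is $H_{\mathrm{top}}(X)=\limsup_{k\to\infty}\frac1k\log N_k(X)$. $N_k^I(X)$ is the number of distinct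 prefix blocks $b_0\cdots b_{k-1}$ of length $k$ of words in $X$, and the prefix entropy is $H_p(X)=\limsup_{k\to\infty}\frac1k\log N_k^I(X)$; $X$ has stable prefix entropy if $\lim_{k\to\infty}\frac1k\log N_k^I(X)$ exists. Logarithms are natural. *)

theory Defs
  imports Complex_Main "HOL-Library.Extended_Real" "HOL-Library.FuncSet"
begin

text \<open>One-sided infinite words are functions of type \<open>nat \<Rightarrow> 'a\<close>; the words over an
  alphabet \<open>A\<close> are the elements of \<open>UNIV \<rightarrow> A\<close>.\<close>

definition shift :: "(nat \<Rightarrow> 'a) \<Rightarrow> (nat \<Rightarrow> 'a)" where
  "shift x = (\<lambda>i. x (Suc i))"

definition weakly_shift_stable :: "(nat \<Rightarrow> 'a) set \<Rightarrow> bool" where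
  "weakly_shift_stable X \<longleftrightarrow> (\<exists>k j. j < k \<and> (shift ^^ k) ` X \<subseteq> (shift ^^ j) ` X)"

text \<open>For \<open>n \<ge> 1\<close> and \<open>i < n\<close>, the letter at position \<open>i + j * n\<close> of the interleaving is
  \<open>xs i j\<close>. Only the values of \<open>xs\<close> at indices below \<open>n\<close> matter.\<close>

definition interleave :: "nat \<Rightarrow> (nat \<Rightarrow> nat \<Rightarrow> 'a) \<Rightarrow> (nat \<Rightarrow> 'a)" where
  "interleave n xs = (\<lambda>m. xs (m mod n) (m div n))"

definition interleaving :: "nat \<Rightarrow> (nat \<Rightarrow> (nat \<Rightarrow> 'a) set) \<Rightarrow> (nat \<Rightarrow> 'a) set" where
  "interleaving n X = {interleave n xs | xs. \<forall>i<n. xs i \<in> X i}"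

definition blocks :: "nat \<Rightarrow> (nat \<Rightarrow> 'a) set \<Rightarrow> 'a list set" where
  "blocks k X = {map x [m..<m + k] | x m. x \<in> X}"

definition prefix_blocks :: "nat \<Rightarrow> (nat \<Rightarrow> 'a) set \<Rightarrow> 'a list set" where
  "prefix_blocks k X = {map x [0..<k] | x. x \<in> X}"

text \<open>The entropies are extended reals because the limit superior is taken in a complete
  lattice. Over a finite alphabet, and for nonempty \<open>X\<close>, the sequences below take values in
  \<open>{0..ln (card A)}\<close>, so both entropies are finite. The term for \<open>k = 0\<close> is \<open>0\<close> and is
  irrelevant for the limit.\<close>

definition top_entropy :: "(nat \<Rightarrow> 'a) set \<Rightarrow> ereal" where
  "top_entropy X = limsup (\<lambda>k. ereal (1 / real k * ln (real (card (blocks k X)))))"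

definition prefix_entropy :: "(nat \<Rightarrow> 'a) set \<Rightarrow> ereal" where
  "prefix_entropy X = limsup (\<lambda>k. ereal (1 / real k * ln (real (card (prefix_blocks k X)))))"

definition stable_prefix_entropy :: "(nat \<Rightarrow> 'a) set \<Rightarrow> bool" where
  "stable_prefix_entropy X \<longleftrightarrow>
     convergent (\<lambda>k. 1 / real k * ln (real (card (prefix_blocks k X))))"

end

(*
  The number of blocks at arbitrary positions is submultiplicative in the length for every set X,
  so (1/k) log N_k(X) converges by Fekete's lemma. Weak shift-stability says that every shift of X
  lies in one of finitely many shifts S^i X with i < d; hence N_k(X) is at most d |A|^d times the
  number of prefix blocks, and both counts have the same exponential growth rate. A length-k block
  of an interleaving is determined by its starting position modulo n and by one block of length
  k div n + 1 from each component, while its prefix blocks of length k surject onto the product of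
  the prefix blocks of length k div n of the components. These two bounds have the same rate.
*)
theory Submission
  imports Defs
begin

section \<open>Fekete's lemma, and growth rates along \<open>k div n\<close>\<close>

section \<open>Limits\<close>

text \<open>Fekete's argument: the limit is the infimum of \<open>a k / k\<close> over
  \<open>k \<ge> 1\<close>. Dividing \<open>k\<close> by a nearly optimal \<open>m\<close> bounds
  \<open>a k\<close> by \<open>k div m\<close> copies of \<open>a m\<close> plus a remainder bounded
  independently of \<open>k\<close>. Nonnegativity keeps the infimum finite and permits the passage
  from \<open>k div m\<close> to \<open>k / m\<close>.\<close>

lemma fekete_nonneg:
  fixes a :: "nat \<Rightarrow> real"
  assumes nonneg: "\<And>m. 0 \<le> a m"
    and subadd: "\<And>m n. a (m + n) \<le> a m + a n"
  shows "convergent (\<lambda>k. 1 / real k * a k)"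
proof -
  define S where "S = (\<lambda>k. 1 / real k * a k) ` {1..}"
  define L where "L = Inf S"
  have S_ne: "S \<noteq> {}" and bdd: "bdd_below S"
    using nonneg by (auto simp: S_def intro!: bdd_belowI[of _ 0])
  have lower: "L \<le> 1 / real k * a k" if "k \<ge> 1" for k
    unfolding L_def using bdd that by (intro cInf_lower) (auto simp: S_def)
  \<comment> \<open>The remainder \<open>r\<close> stays in the statement so that the induction on
    \<open>q\<close> starts from a trivial inequality, with no estimate of
    \<open>a 0\<close>.\<close>
  have mult: "a (q * m + r) \<le> real q * a m + a r" for q m r
  proof (induction q)
    case (Suc q)
    have "a (Suc q * m + r) = a (m + (q * m + r))"
      by (simp add: ac_simps)
    also have "\<dots> \<le> a m + a (q * m + r)"
      by (rule subadd)
    finally show ?case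
      using Suc by (simp add: algebra_simps)
  qed simp
  have "(\<lambda>k. 1 / real k * a k) \<longlonglongrightarrow> L"
  proof (rule LIMSEQ_I)
    fix e :: real
    assume "0 < e"
    then have "Inf S < L + e / 2"
      by (simp add: L_def)
    then obtain m where m: "m \<ge> 1" and am: "1 / real m * a m < L + e / 2"
      using cInf_lessD[OF S_ne] by (auto simp: S_def)
    \<comment> \<open>One constant dominates every remainder term; the terms being nonnegative,
      their sum can stand in for their maximum.\<close>
    define C where "C = (\<Sum>r<m. a r)"
    have C: "a r \<le> C" if "r < m" for r
      unfolding C_def using that nonneg by (intro member_le_sum) auto
    have upper: "1 / real k * a k \<le> 1 / real m * a m + C / real k" if "k \<ge> 1" for k
    proof -
      have "a k = a (k div m * m + k mod m)"
        by simp
      also have "\<dots> \<le> real (k div m) * a m + a (k mod m)"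
        by (rule mult)
      also have "\<dots> \<le> real k / real m * a m + C"
      proof (intro add_mono mult_right_mono C nonneg)
        show "real (k div m) \<le> real k / real m"
          by (rule of_nat_div_le_of_nat)
        show "k mod m < m"
          using m by simp
      qed
      finally show ?thesis
        using that by (simp add: field_simps)
    qed
    have "(\<lambda>k. C / real k) \<longlonglongrightarrow> 0"
      by (rule lim_const_over_n)
    then have "\<forall>\<^sub>F k in sequentially. C / real k < e / 2"
      using \<open>0 < e\<close> by (intro order_tendstoD(2)[of _ 0]) auto
    then obtain K where K: "\<And>k. k \<ge> K \<Longrightarrow> C / real k < e / 2"
      by (auto simp: eventually_sequentially)
    have "norm (1 / real k * a k - L) < e" if "k \<ge> max 1 K" for k
    proof -
      have "L \<le> 1 / real k * a k" "1 / real k * a k \<le> 1 / real m * a m + C / real k"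
        "C / real k < e / 2"
        using lower upper K that by auto
      then show ?thesis
        using am unfolding real_norm_def by linarith
    qed
    then show "\<exists>no. \<forall>k\<ge>no. norm (1 / real k * a k - L) < e"
      by blast
  qed
  then show ?thesis
    by (rule convergentI)
qed

text \<open>The quotient \<open>k div n\<close> differs from \<open>k / n\<close> by at most 1, an
  error of \<open>1 / k\<close> after division by \<open>k\<close>.\<close>

lemma div_over_tendsto:
  assumes "1 \<le> n"
  shows "(\<lambda>k. real (k div n) / real k) \<longlonglongrightarrow> 1 / real n"
proof (rule tendsto_sandwich)
  show "\<forall>\<^sub>F k in sequentially. 1 / real n - 1 / real k \<le> real (k div n) / real k"
  proof (rule eventually_sequentiallyI[of 1])
    fix k :: nat
    assume "1 \<le> k"
    have "real k / real n - 1 \<le> real (k div n)"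
      using floor_divide_of_nat_eq[where 'a = real, of k n] by linarith
    then show "1 / real n - 1 / real k \<le> real (k div n) / real k"
      using divide_right_mono[of "real k / real n - 1" _ "real k"] \<open>1 \<le> k\<close>
      by (simp add: diff_divide_distrib)
  qed
  show "\<forall>\<^sub>F k in sequentially. real (k div n) / real k \<le> 1 / real n"
  proof (rule eventually_sequentiallyI[of 1])
    fix k :: nat
    assume "1 \<le> k"
    then show "real (k div n) / real k \<le> 1 / real n"
      using of_nat_div_le_of_nat[where 'a = real, of k n] by (simp add: field_simps)
  qed
  show "(\<lambda>k. 1 / real n - 1 / real k) \<longlonglongrightarrow> 1 / real n"
    using tendsto_diff[OF tendsto_const lim_const_over_n[of 1]] by simp
qed simp

text \<open>Factor \<open>f (g k) / k\<close> as \<open>g k / k\<close> times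
  \<open>f (g k) / g k\<close>. This transfers the rates of the components, at lengths
  \<open>k div n\<close> and \<open>k div n + 1\<close>, to the length \<open>k\<close> of the
  interleaving.\<close>

lemma rate_compose:
  fixes f :: "nat \<Rightarrow> real"
  assumes f: "(\<lambda>m. 1 / real m * f m) \<longlonglongrightarrow> h"
    and g: "filterlim g sequentially sequentially"
    and c: "(\<lambda>k. real (g k) / real k) \<longlonglongrightarrow> c"
  shows "(\<lambda>k. 1 / real k * f (g k)) \<longlonglongrightarrow> c * h"
proof -
  have "(\<lambda>k. real (g k) / real k * (1 / real (g k) * f (g k))) \<longlonglongrightarrow> c * h"
    by (intro tendsto_mult c filterlim_compose[OF f g])
  \<comment> \<open>The factor \<open>g k\<close> cancels where it is nonzero, hence
    eventually.\<close>
  moreover have "\<forall>\<^sub>F k in sequentially. 1 \<le> g k"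
    using g by (simp add: filterlim_at_top)
  then have "\<forall>\<^sub>F k in sequentially.
      real (g k) / real k * (1 / real (g k) * f (g k)) = 1 / real k * f (g k)"
    by eventually_elim simp
  ultimately show ?thesis
    by (rule Lim_transform_eventually)
qed

lemma filterlim_div_at_top:
  assumes "1 \<le> (n :: nat)"
  shows "filterlim (\<lambda>k. k div n) sequentially sequentially"
  unfolding filterlim_at_top eventually_sequentially
proof (intro allI)
  fix Z
  have "Z \<le> k div n" if "Z * n \<le> k" for k
    using div_le_mono[OF that, of n] assms by simp
  then show "\<exists>N. \<forall>k\<ge>N. Z \<le> k div n"
    by blast
qed

section \<open>Block and prefix counts, and their growth under extension\<close>

section \<open>Counting blocks\<close>

lemma prefix_blocks_subset_blocks: "prefix_blocks k X \<subseteq> blocks k X"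
proof
  fix w
  assume "w \<in> prefix_blocks k X"
  then obtain x where "x \<in> X" "w = map x [0..<0 + k]"
    by (auto simp: prefix_blocks_def)
  then show "w \<in> blocks k X"
    unfolding blocks_def by blast
qed

lemma blocks_subset_lists:
  assumes "X \<subseteq> UNIV \<rightarrow> A"
  shows "blocks k X \<subseteq> {u. set u \<subseteq> A \<and> length u = k}"
  using assms by (fastforce simp: blocks_def Pi_iff)

lemma finite_blocks:
  assumes "finite A" "X \<subseteq> UNIV \<rightarrow> A"
  shows "finite (blocks k X)"
  using finite_subset[OF blocks_subset_lists[OF assms(2)] finite_lists_length_eq[OF assms(1)]] .

lemma finite_prefix_blocks:
  assumes "finite A" "X \<subseteq> UNIV \<rightarrow> A"
  shows "finite (prefix_blocks k X)"
  using finite_subset[OF prefix_blocks_subset_blocks finite_blocks[OF assms]] .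

lemma card_prefix_blocks_pos:
  assumes "finite A" "X \<subseteq> UNIV \<rightarrow> A" "X \<noteq> {}"
  shows "0 < card (prefix_blocks k X)"
  using finite_prefix_blocks[OF assms(1,2)] assms(3)
  by (auto simp: card_gt_0_iff prefix_blocks_def)

lemma card_prefix_blocks_le_blocks:
  assumes "finite A" "X \<subseteq> UNIV \<rightarrow> A"
  shows "card (prefix_blocks k X) \<le> card (blocks k X)"
  by (rule card_mono[OF finite_blocks[OF assms] prefix_blocks_subset_blocks])

lemma card_blocks_pos:
  assumes "finite A" "X \<subseteq> UNIV \<rightarrow> A" "X \<noteq> {}"
  shows "0 < card (blocks k X)"
  using card_prefix_blocks_pos[OF assms] card_prefix_blocks_le_blocks[OF assms(1,2)]
  by (rule less_le_trans)

text \<open>Cut a block after its first \<open>k\<close> letters. Since blocks are taken at all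
  positions, the second piece is again a block of \<open>X\<close>, and the two pieces determine the
  whole.\<close>

lemma card_blocks_add:
  assumes "finite A" "X \<subseteq> UNIV \<rightarrow> A"
  shows "card (blocks (k + l) X) \<le> card (blocks k X) * card (blocks l X)"
proof -
  have "blocks (k + l) X \<subseteq> (\<lambda>(u, v). u @ v) ` (blocks k X \<times> blocks l X)"
  proof
    fix w
    assume "w \<in> blocks (k + l) X"
    then obtain x m where x: "x \<in> X" and w: "w = map x [m..<m + (k + l)]"
      by (auto simp: blocks_def)
    have "w = map x [m..<m + k] @ map x [m + k..<m + k + l]"
      unfolding w map_append[symmetric] by (metis add.assoc le_add1 upt_add_eq_append)
    then show "w \<in> (\<lambda>(u, v). u @ v) ` (blocks k X \<times> blocks l X)"
      using x by (force simp: blocks_def)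
  qed
  then have "card (blocks (k + l) X) \<le> card (blocks k X \<times> blocks l X)"
    using finite_blocks[OF assms] by (intro surj_card_le) auto
  then show ?thesis
    by (simp add: card_cartesian_product)
qed

text \<open>Logarithms turn submultiplicativity into subadditivity, so Fekete's lemma
  applies.\<close>

lemma blocks_rate_convergent:
  assumes "finite A" "X \<subseteq> UNIV \<rightarrow> A" "X \<noteq> {}"
  shows "convergent (\<lambda>k. 1 / real k * ln (real (card (blocks k X))))"
proof (rule fekete_nonneg)
  note pos = card_blocks_pos[OF assms]
  show "0 \<le> ln (real (card (blocks m X)))" for m
    using pos[of m] by simp
  show "ln (real (card (blocks (m + n) X)))
      \<le> ln (real (card (blocks m X))) + ln (real (card (blocks n X)))" for m n
  proof -
    have "ln (real (card (blocks (m + n) X)))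
        \<le> ln (real (card (blocks m X)) * real (card (blocks n X)))"
      using pos card_blocks_add[OF assms(1,2), of m n]
      by (subst ln_le_cancel_iff) (auto simp flip: of_nat_mult)
    also have "\<dots> = ln (real (card (blocks m X))) + ln (real (card (blocks n X)))"
      using pos by (simp add: ln_mult)
    finally show ?thesis .
  qed
qed

lemma prefix_blocks_take:
  assumes "k \<le> l"
  shows "prefix_blocks k X = take k ` prefix_blocks l X"
  using assms by (force simp: prefix_blocks_def take_map image_iff)

text \<open>The last \<open>l\<close> letters need not form a prefix of a word in \<open>X\<close>,
  so they are counted merely as words over \<open>A\<close>. This crude factor is harmless later,
  where \<open>l\<close> is fixed and \<open>k\<close> grows.\<close>

lemma card_prefix_blocks_add:
  assumes "finite A" "X \<subseteq> UNIV \<rightarrow> A"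
  shows "card (prefix_blocks (k + l) X) \<le> card (prefix_blocks k X) * card A ^ l"
proof -
  let ?L = "{u. set u \<subseteq> A \<and> length u = l}"
  have "prefix_blocks (k + l) X \<subseteq> (\<lambda>(u, v). u @ v) ` (prefix_blocks k X \<times> ?L)"
  proof
    fix w
    assume "w \<in> prefix_blocks (k + l) X"
    then obtain x where x: "x \<in> X" and w: "w = map x [0..<k + l]"
      by (auto simp: prefix_blocks_def)
    have "w = map x [0..<k] @ map x [k..<k + l]"
      unfolding w map_append[symmetric] by (metis le0 upt_add_eq_append)
    moreover have "map x [k..<k + l] \<in> ?L"
      using x assms(2) by auto
    moreover have "map x [0..<k] \<in> prefix_blocks k X"
      using x by (auto simp: prefix_blocks_def)
    ultimately show "w \<in> (\<lambda>(u, v). u @ v) ` (prefix_blocks k X \<times> ?L)"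
      by force
  qed
  then have "card (prefix_blocks (k + l) X) \<le> card (prefix_blocks k X \<times> ?L)"
    using finite_prefix_blocks[OF assms] finite_lists_length_eq[OF assms(1)]
    by (intro surj_card_le) auto
  then show ?thesis
    by (simp add: card_cartesian_product card_lists_length_eq assms(1))
qed

section \<open>Weak shift-stability: equal growth of blocks and prefixes\<close>

section \<open>Weakly shift-stable sets\<close>

lemma funpow_shift: "(shift ^^ m) x = (\<lambda>i. x (m + i))"
  by (induction m) (auto simp: shift_def)

text \<open>Applying the shift \<open>m - d\<close> more times to the inclusion of the
  \<open>d\<close>-th shift in the \<open>j\<close>-th puts the \<open>m\<close>-th shift of
  \<open>X\<close> inside the one with exponent \<open>m - d + j < m\<close>. Strong induction
  descends in this way until the exponent is below \<open>d\<close>.\<close>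

lemma weakly_shift_stable_finitely_many_shifts:
  assumes "weakly_shift_stable X"
  obtains d where "\<And>m. \<exists>i<d. (shift ^^ m) ` X \<subseteq> (shift ^^ i) ` X"
proof -
  obtain d j where jd: "j < d" and sub: "(shift ^^ d) ` X \<subseteq> (shift ^^ j) ` X"
    using assms by (auto simp: weakly_shift_stable_def)
  have shifts: "\<exists>i<d. (shift ^^ m) ` X \<subseteq> (shift ^^ i) ` X" for m
  proof (induction m rule: less_induct)
    case (less m)
    show ?case
    proof (cases "m < d")
      case False
      define r where "r = m - d"
      have m: "m = r + d"
        using False by (simp add: r_def)
      have "(shift ^^ m) ` X = (shift ^^ r) ` (shift ^^ d) ` X"
        by (simp add: m funpow_add image_comp)
      also have "\<dots> \<subseteq> (shift ^^ r) ` (shift ^^ j) ` X"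
        using sub by (rule image_mono)
      also have "\<dots> = (shift ^^ (r + j)) ` X"
        by (simp add: funpow_add image_comp)
      finally have "(shift ^^ m) ` X \<subseteq> (shift ^^ (r + j)) ` X" .
      moreover have "r + j < m"
        using jd m by simp
      ultimately show ?thesis
        using less.IH by (meson order_trans)
    qed auto
  qed
  show thesis
    by (rule that[OF shifts])
qed

text \<open>A block at position \<open>m\<close> is a prefix of a word in the \<open>m\<close>-th
  shift of \<open>X\<close>, hence of one in the \<open>i\<close>-th shift for some
  \<open>i < d\<close>. It is therefore a prefix of length \<open>i + k\<close> with
  \<open>i\<close> letters dropped. The factor \<open>d\<close> counts the choices of
  \<open>i\<close>, and \<open>card A ^ d\<close> pays for the longer prefixes.\<close>

lemma card_blocks_le_prefix_blocks:
  assumes "finite A" "X \<subseteq> UNIV \<rightarrow> A"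
    and "\<And>m. \<exists>i<d. (shift ^^ m) ` X \<subseteq> (shift ^^ i) ` X"
  shows "card (blocks k X) \<le> d * card A ^ d * card (prefix_blocks k X)"
proof -
  have "blocks k X \<subseteq> (\<Union>i<d. drop i ` prefix_blocks (i + k) X)"
  proof
    fix w
    assume "w \<in> blocks k X"
    then obtain x m where x: "x \<in> X" and w: "w = map x [m..<m + k]"
      by (auto simp: blocks_def)
    obtain i y where i: "i < d" and y: "y \<in> X" and eq: "(shift ^^ m) x = (shift ^^ i) y"
      using assms(3)[of m] x by blast
    have "x (m + t) = y (i + t)" for t
      using fun_cong[OF eq, of t] by (simp add: funpow_shift)
    then have "w = drop i (map y [0..<i + k])"
      by (intro nth_equalityI) (auto simp: w)
    then show "w \<in> (\<Union>i<d. drop i ` prefix_blocks (i + k) X)"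
      using i y by (auto simp: prefix_blocks_def)
  qed
  then have "card (blocks k X) \<le> card (\<Union>i<d. drop i ` prefix_blocks (i + k) X)"
    using finite_prefix_blocks[OF assms(1,2)] by (intro card_mono) auto
  also have "\<dots> \<le> (\<Sum>i<d. card (drop i ` prefix_blocks (i + k) X))"
    by (rule card_UN_le) simp
  \<comment> \<open>Prefixes of the various lengths \<open>i + k\<close> are truncations of prefixes
    of the common length \<open>k + d\<close>, so each term gets the same bound.\<close>
  also have "\<dots> \<le> (\<Sum>i<d. card (prefix_blocks (k + d) X))"
  proof (rule sum_mono)
    fix i
    assume "i \<in> {..<d}"
    then have "prefix_blocks (i + k) X = take (i + k) ` prefix_blocks (k + d) X"
      by (intro prefix_blocks_take) auto
    then have "card (prefix_blocks (i + k) X) \<le> card (prefix_blocks (k + d) X)"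
      using card_image_le[OF finite_prefix_blocks[OF assms(1,2)]] by metis
    then show "card (drop i ` prefix_blocks (i + k) X) \<le> card (prefix_blocks (k + d) X)"
      using card_image_le[OF finite_prefix_blocks[OF assms(1,2)]] le_trans by blast
  qed
  also have "\<dots> \<le> d * (card (prefix_blocks k X) * card A ^ d)"
    using card_prefix_blocks_add[OF assms(1,2), of k d] by simp
  finally show ?thesis
    by (simp add: ac_simps)
qed

text \<open>The block and prefix counts differ by at most a factor \<open>C\<close> independent of
  \<open>k\<close>, which changes the rate by at most \<open>ln C / k\<close>. The convergence known
  for blocks thus carries over to prefixes, with the same limit.\<close>

lemma weakly_shift_stable_rates:
  assumes "finite A" "X \<subseteq> UNIV \<rightarrow> A" "X \<noteq> {}" "weakly_shift_stable X"
  obtains h where "(\<lambda>k. 1 / real k * ln (real (card (blocks k X)))) \<longlonglongrightarrow> h"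
    and "(\<lambda>k. 1 / real k * ln (real (card (prefix_blocks k X)))) \<longlonglongrightarrow> h"
proof -
  obtain h where h: "(\<lambda>k. 1 / real k * ln (real (card (blocks k X)))) \<longlonglongrightarrow> h"
    using blocks_rate_convergent[OF assms(1-3)] by (auto simp: convergent_def)
  obtain d where d: "\<And>m. \<exists>i<d. (shift ^^ m) ` X \<subseteq> (shift ^^ i) ` X"
    using weakly_shift_stable_finitely_many_shifts[OF assms(4)] by blast
  define C where "C = d * card A ^ d"
  have le: "card (blocks k X) \<le> C * card (prefix_blocks k X)" for k
    using card_blocks_le_prefix_blocks[OF assms(1,2) d] by (simp add: C_def)
  note pos = card_blocks_pos[OF assms(1-3)] card_prefix_blocks_pos[OF assms(1-3)]
  \<comment> \<open>At length 0 the block count is already positive, and the inequality then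
    excludes \<open>C = 0\<close>.\<close>
  have C: "0 < C"
    using le[of 0] pos(1)[of 0] by (cases C) auto
  have "(\<lambda>k. 1 / real k * ln (real (card (prefix_blocks k X)))) \<longlonglongrightarrow> h"
  proof (rule tendsto_sandwich)
    show "\<forall>\<^sub>F k in sequentially. 1 / real k * ln (real (card (blocks k X))) - ln (real C) / real k
        \<le> 1 / real k * ln (real (card (prefix_blocks k X)))"
    proof (intro always_eventually allI)
      fix k
      have "ln (real (card (blocks k X))) \<le> ln (real C * real (card (prefix_blocks k X)))"
        using pos C le[of k] by (subst ln_le_cancel_iff) (auto simp flip: of_nat_mult)
      also have "\<dots> = ln (real C) + ln (real (card (prefix_blocks k X)))"
        using pos C by (simp add: ln_mult)
      finally show "1 / real k * ln (real (card (blocks k X))) - ln (real C) / real k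
          \<le> 1 / real k * ln (real (card (prefix_blocks k X)))"
        by (simp add: divide_right_mono flip: diff_divide_distrib)
    qed
    show "\<forall>\<^sub>F k in sequentially. 1 / real k * ln (real (card (prefix_blocks k X)))
        \<le> 1 / real k * ln (real (card (blocks k X)))"
      using pos card_prefix_blocks_le_blocks[OF assms(1,2)]
      by (intro always_eventually allI mult_left_mono) auto
    show "(\<lambda>k. 1 / real k * ln (real (card (blocks k X))) - ln (real C) / real k) \<longlonglongrightarrow> h"
      using tendsto_diff[OF h lim_const_over_n] by simp
  qed (rule h)
  with h that show thesis
    by blast
qed

lemma top_entropy_eqI:
  "(\<lambda>k. 1 / real k * ln (real (card (blocks k X)))) \<longlonglongrightarrow> h \<Longrightarrow> top_entropy X = ereal h"
  unfolding top_entropy_def by (intro lim_imp_Limsup) (auto intro: tendsto_ereal)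

lemma prefix_entropy_eqI:
  "(\<lambda>k. 1 / real k * ln (real (card (prefix_blocks k X)))) \<longlonglongrightarrow> h \<Longrightarrow> prefix_entropy X = ereal h"
  unfolding prefix_entropy_def by (intro lim_imp_Limsup) (auto intro: tendsto_ereal)

section \<open>Two-sided bounds for the block counts of an interleaving\<close>

section \<open>Interleavings\<close>

lemma interleaving_subset:
  assumes "1 \<le> n" "\<forall>i<n. X i \<subseteq> UNIV \<rightarrow> A"
  shows "interleaving n X \<subseteq> UNIV \<rightarrow> A"
proof
  fix x
  assume "x \<in> interleaving n X"
  then obtain xs where x: "x = interleave n xs" "\<And>i. i < n \<Longrightarrow> xs i \<in> X i"
    by (auto simp: interleaving_def)
  have "xs (m mod n) \<in> UNIV \<rightarrow> A" for m
    using x(2)[of "m mod n"] spec[OF assms(2), of "m mod n"] assms(1) by auto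
  then show "x \<in> UNIV \<rightarrow> A"
    by (auto simp: x(1) interleave_def)
qed

text \<open>A window of length \<open>k\<close> meets each residue class modulo \<open>n\<close> in
  at most \<open>k div n + 1\<close> positions, and these are consecutive in the corresponding
  component. The starting residue, which gives the factor \<open>n\<close>, and one block per
  component therefore determine the window.\<close>

lemma card_blocks_interleaving_le:
  fixes X :: "nat \<Rightarrow> (nat \<Rightarrow> 'a) set"
  assumes "finite A" "1 \<le> n" "\<forall>i<n. X i \<subseteq> UNIV \<rightarrow> A"
  shows "card (blocks k (interleaving n X)) \<le> n * (\<Prod>i<n. card (blocks (k div n + 1) (X i)))"
proof -
  let ?l = "k div n + 1"
  let ?P = "PiE {..<n} (\<lambda>i. blocks ?l (X i))"
  \<comment> \<open>A block starting at position \<open>q * n + r\<close> with \<open>r < n\<close> meets the component \<open>i\<close> from position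
    \<open>q + s r i\<close> on.\<close>
  define s where "s r i = (if i < r then 1 else 0 :: nat)" for r i :: nat
  \<comment> \<open>The decoder uses only the residue \<open>r\<close> and the component blocks: the
    quotient \<open>q\<close> of the starting position is absorbed into where those blocks
    begin.\<close>
  define F where
    "F r b = map (\<lambda>t. b ((r + t) mod n) ! ((r + t) div n - s r ((r + t) mod n))) [0..<k]"
    for r :: nat and b :: "nat \<Rightarrow> 'a list"
  have "blocks k (interleaving n X) \<subseteq> (\<lambda>(r, b). F r b) ` ({..<n} \<times> ?P)"
  proof
    fix w
    assume "w \<in> blocks k (interleaving n X)"
    then obtain xs m where xs: "\<And>i. i < n \<Longrightarrow> xs i \<in> X i"
      and w: "w = map (interleave n xs) [m..<m + k]"
      by (auto simp: blocks_def interleaving_def)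
    define q r where "q = m div n" and "r = m mod n"
    have m: "m = q * n + r" and r: "r < n"
      using assms(2) by (auto simp: q_def r_def)
    define b where "b = restrict (\<lambda>i. map (xs i) [q + s r i..<q + s r i + ?l]) {..<n}"
    have "b \<in> ?P"
      using xs by (auto simp: b_def blocks_def)
    moreover have "w = F r b"
    proof (rule nth_equalityI)
      fix t
      assume "t < length w"
      then have t: "t < k"
        by (simp add: w)
      define i c where "i = (r + t) mod n" and "c = (r + t) div n"
      have i: "i < n" and rt: "r + t = c * n + i"
        using assms(2) by (auto simp: i_def c_def)
      \<comment> \<open>If \<open>c = 0\<close> then \<open>i = r + t \<ge> r\<close>, so
        \<open>s r i = 0\<close>; the natural subtraction \<open>c - s r i\<close> never
        truncates.\<close>
      have lower: "s r i \<le> c"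
        using rt by (cases c) (auto simp: s_def)
      \<comment> \<open>The index falls inside the component block. For \<open>r \<le> i\<close> the
        offset \<open>r\<close> is absorbed by \<open>i\<close>; for \<open>i < r\<close> the
        quotient \<open>c\<close> may be one larger, but the block also begins one position
        later.\<close>
      have "c < k div n + 1 + s r i"
      proof -
        have "c * n + i < k + r"
          using rt t by linarith
        moreover have "k < (k div n + 1) * n"
          using assms(2) dividend_less_div_times[of n k] by simp
        ultimately have *: "c * n + i < (k div n + 1) * n + r"
          by linarith
        show ?thesis
        proof (cases "i < r")
          case True
          have "c * n < (k div n + 2) * n"
            using * r by simp
          then have "c < k div n + 2"
            by (rule mult_less_cancel2[THEN iffD1, THEN conjunct2])
          then show ?thesis
            using True by (simp add: s_def)
        next
          case False
          then have "c * n < (k div n + 1) * n"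
            using * by linarith
          then have "c < k div n + 1"
            by (rule mult_less_cancel2[THEN iffD1, THEN conjunct2])
          then show ?thesis
            by simp
        qed
      qed
      with lower have "c - s r i < ?l" "q + s r i + (c - s r i) = q + c"
        by auto
      then have "b i ! (c - s r i) = xs i (q + c)"
        using i by (simp add: b_def del: upt_Suc)
      moreover have "m + t = (q + c) * n + i"
        using rt by (simp add: m algebra_simps)
      then have "(m + t) mod n = i" "(m + t) div n = q + c"
        using i assms(2) by auto
      ultimately show "w ! t = F r b ! t"
        using t by (simp add: w F_def interleave_def i_def c_def)
    qed (simp add: w F_def)
    ultimately show "w \<in> (\<lambda>(r, b). F r b) ` ({..<n} \<times> ?P)"
      using r by auto
  qed
  then have "card (blocks k (interleaving n X)) \<le> card ({..<n} \<times> ?P)"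
    using finite_blocks[OF assms(1)] assms(3)
    by (intro surj_card_le finite_cartesian_product finite_PiE) auto
  then show ?thesis
    by (simp add: card_cartesian_product card_PiE)
qed

text \<open>Prefixes of length \<open>k div n\<close> can be chosen independently in the components,
  and all of them can be read off from the first \<open>k\<close> letters of the interleaved word.
  The map \<open>G\<close> does this reading, so it covers the whole product.\<close>

lemma card_prefix_blocks_interleaving_ge:
  fixes X :: "nat \<Rightarrow> (nat \<Rightarrow> 'a) set"
  assumes "finite A" "1 \<le> n" "\<forall>i<n. X i \<subseteq> UNIV \<rightarrow> A"
  shows "(\<Prod>i<n. card (prefix_blocks (k div n) (X i))) \<le> card (prefix_blocks k (interleaving n X))"
proof -
  let ?P = "PiE {..<n} (\<lambda>i. prefix_blocks (k div n) (X i))"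
  define G where "G w = restrict (\<lambda>i. map (\<lambda>t. w ! (i + t * n)) [0..<k div n]) {..<n}"
    for w :: "'a list"
  have "?P \<subseteq> G ` prefix_blocks k (interleaving n X)"
  proof
    fix b
    assume b: "b \<in> ?P"
    \<comment> \<open>With the implication inside the existential, choice yields a total function
      \<open>xs\<close>, arbitrary from index \<open>n\<close> on.\<close>
    then have "\<forall>i. \<exists>x. i < n \<longrightarrow> x \<in> X i \<and> b i = map x [0..<k div n]"
      by (fastforce simp: prefix_blocks_def PiE_iff)
    then obtain xs where xs: "\<And>i. i < n \<Longrightarrow> xs i \<in> X i"
      and bi: "\<And>i. i < n \<Longrightarrow> b i = map (xs i) [0..<k div n]"
      by metis
    define w where "w = map (interleave n xs) [0..<k]"
    have "w ! (i + t * n) = xs i t" if "i < n" "t < k div n" for i t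
    proof -
      \<comment> \<open>The \<open>k div n\<close> complete rounds of \<open>n\<close> letters fit
        into the first \<open>k\<close> letters.\<close>
      have "i + t * n < Suc t * n"
        using that by simp
      also have "\<dots> \<le> k div n * n"
        using that by (intro mult_le_mono1) simp
      also have "\<dots> \<le> k"
        by simp
      finally show ?thesis
        using that by (simp add: w_def interleave_def)
    qed
    then have "G w i = b i" if "i < n" for i
      using that by (simp add: G_def bi)
    moreover have "G w i = b i" if "\<not> i < n" for i
      using that PiE_arb[OF b, of i] by (simp add: G_def)
    ultimately have "b = G w"
      by (intro ext) metis
    moreover have "w \<in> prefix_blocks k (interleaving n X)"
      using xs by (auto simp: w_def prefix_blocks_def interleaving_def)
    ultimately show "b \<in> G ` prefix_blocks k (interleaving n X)"
      by blast
  qed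
  then have "card ?P \<le> card (prefix_blocks k (interleaving n X))"
    using finite_prefix_blocks[OF assms(1) interleaving_subset[OF assms(2,3)]]
    by (intro surj_card_le) auto
  then show ?thesis
    by (simp add: card_PiE)
qed

text \<open>The block count lies between the product of prefix counts at length
  \<open>k div n\<close> and \<open>n\<close> times the product of block counts at length
  \<open>k div n + 1\<close>. The bounds have the same rate because each component has one limit
  \<open>h i\<close> for both kinds of count.\<close>

lemma interleaving_rate:
  assumes A: "finite A" and n: "1 \<le> n" and X: "\<forall>i<n. X i \<subseteq> UNIV \<rightarrow> A"
    and ne: "\<And>i. i < n \<Longrightarrow> X i \<noteq> {}"
    and h: "\<And>i. i < n \<Longrightarrow> (\<lambda>k. 1 / real k * ln (real (card (blocks k (X i))))) \<longlonglongrightarrow> h i"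
    and hp: "\<And>i. i < n \<Longrightarrow> (\<lambda>k. 1 / real k * ln (real (card (prefix_blocks k (X i))))) \<longlonglongrightarrow> h i"
  shows "(\<lambda>k. 1 / real k * ln (real (card (blocks k (interleaving n X)))))
    \<longlonglongrightarrow> 1 / real n * (\<Sum>i<n. h i)"
proof (rule tendsto_sandwich)
  let ?N = "\<lambda>k. card (blocks k (interleaving n X))"
  let ?B = "\<lambda>k i. card (blocks (k div n + 1) (X i))"
  let ?P = "\<lambda>k i. card (prefix_blocks (k div n) (X i))"
  have B: "0 < ?B k i" and P: "0 < ?P k i" if "i < n" for k i
    using card_blocks_pos[OF A _ ne[OF that]]
      card_prefix_blocks_pos[OF A _ ne[OF that]] X that by auto
  have P_prod: "0 < (\<Prod>i<n. ?P k i)" and B_prod: "0 < (\<Prod>i<n. ?B k i)" for k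
    using B P by (auto intro!: prod_pos)
  have ge: "(\<Prod>i<n. ?P k i) \<le> ?N k" for k
    using card_prefix_blocks_interleaving_ge[OF A n X]
      card_prefix_blocks_le_blocks[OF A interleaving_subset[OF n X]] by (rule le_trans)
  have N: "0 < ?N k" for k
    using P_prod ge by (rule less_le_trans)
  show "\<forall>\<^sub>F k in sequentially. (\<Sum>i<n. 1 / real k * ln (real (?P k i))) \<le> 1 / real k * ln (real (?N k))"
  proof (intro always_eventually allI)
    fix k
    have "(\<Sum>i<n. ln (real (?P k i))) = ln (real (\<Prod>i<n. ?P k i))"
      using P by (subst of_nat_prod, subst ln_prod) auto
    also have "\<dots> \<le> ln (real (?N k))"
      using P_prod N ge by (subst ln_le_cancel_iff) (auto simp del: of_nat_prod)
    finally show "(\<Sum>i<n. 1 / real k * ln (real (?P k i))) \<le> 1 / real k * ln (real (?N k))"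
      unfolding sum_distrib_left[symmetric] by (rule mult_left_mono) simp
  qed
  show "\<forall>\<^sub>F k in sequentially. 1 / real k * ln (real (?N k))
      \<le> ln (real n) / real k + (\<Sum>i<n. 1 / real k * ln (real (?B k i)))"
  proof (intro always_eventually allI)
    fix k
    have "ln (real (?N k)) \<le> ln (real (n * (\<Prod>i<n. ?B k i)))"
      using N card_blocks_interleaving_le[OF A n X, of k] B_prod[of k] n
      by (subst ln_le_cancel_iff) (auto simp del: of_nat_mult of_nat_prod)
    also have "\<dots> = ln (real n) + ln (real (\<Prod>i<n. ?B k i))"
      using n B_prod[of k] by (subst of_nat_mult, subst ln_mult_pos) (auto simp del: of_nat_prod)
    also have "ln (real (\<Prod>i<n. ?B k i)) = (\<Sum>i<n. ln (real (?B k i)))"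
      using B by (subst of_nat_prod, subst ln_prod) auto
    finally have "1 / real k * ln (real (?N k))
        \<le> 1 / real k * (ln (real n) + (\<Sum>i<n. ln (real (?B k i))))"
      by (rule mult_left_mono) simp
    then show "1 / real k * ln (real (?N k))
        \<le> ln (real n) / real k + (\<Sum>i<n. 1 / real k * ln (real (?B k i)))"
      unfolding sum_distrib_left[symmetric] by (simp add: add_divide_distrib)
  qed
  show "(\<lambda>k. \<Sum>i<n. 1 / real k * ln (real (?P k i))) \<longlonglongrightarrow> 1 / real n * (\<Sum>i<n. h i)"
    unfolding sum_distrib_left
    by (intro tendsto_sum rate_compose hp filterlim_div_at_top div_over_tendsto n) auto
  \<comment> \<open>The additional letter per component in the upper bound costs only
    \<open>1 / k\<close>.\<close>
  have "(\<lambda>k. real (k div n) / real k + 1 / real k) \<longlonglongrightarrow> 1 / real n + 0"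
    by (intro tendsto_add div_over_tendsto n lim_const_over_n)
  then have "(\<lambda>k. real (k div n + 1) / real k) \<longlonglongrightarrow> 1 / real n"
    by (simp add: add_divide_distrib add.commute)
  moreover have "filterlim (\<lambda>k. k div n + 1) sequentially sequentially"
    using filterlim_compose[OF filterlim_Suc filterlim_div_at_top[OF n]] by simp
  ultimately have "(\<lambda>k. \<Sum>i<n. 1 / real k * ln (real (?B k i))) \<longlonglongrightarrow> (\<Sum>i<n. 1 / real n * h i)"
    using h by (intro tendsto_sum rate_compose) auto
  then have "(\<lambda>k. ln (real n) / real k + (\<Sum>i<n. 1 / real k * ln (real (?B k i))))
      \<longlonglongrightarrow> 0 + (\<Sum>i<n. 1 / real n * h i)"
    by (intro tendsto_add lim_const_over_n)
  then show "(\<lambda>k. ln (real n) / real k + (\<Sum>i<n. 1 / real k * ln (real (?B k i))))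
      \<longlonglongrightarrow> 1 / real n * (\<Sum>i<n. h i)"
    by (simp add: sum_distrib_left)
qed

section \<open>Entropy identities read off from the growth rates\<close>

theorem theorem2p20:
  fixes A :: "'a set"
  assumes "finite A"
  shows "(\<forall>X. X \<subseteq> (UNIV \<rightarrow> A) \<and> X \<noteq> {} \<and> weakly_shift_stable X \<longrightarrow>
            stable_prefix_entropy X \<and> prefix_entropy X = top_entropy X) \<and>
         (\<forall>(n::nat) X. 1 \<le> n \<and>
            (\<forall>i<n. X i \<subseteq> (UNIV \<rightarrow> A) \<and> X i \<noteq> {} \<and> weakly_shift_stable (X i)) \<longrightarrow>
            top_entropy (interleaving n X) = ereal (1 / real n) * (\<Sum>i<n. top_entropy (X i)))"
proof (intro conjI allI impI; elim conjE)
  fix X :: "(nat \<Rightarrow> 'a) set"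
  assume X: "X \<subseteq> UNIV \<rightarrow> A" "X \<noteq> {}" "weakly_shift_stable X"
  obtain h where h: "(\<lambda>k. 1 / real k * ln (real (card (blocks k X)))) \<longlonglongrightarrow> h"
    "(\<lambda>k. 1 / real k * ln (real (card (prefix_blocks k X)))) \<longlonglongrightarrow> h"
    by (rule weakly_shift_stable_rates[OF assms X])
  show "stable_prefix_entropy X"
    unfolding stable_prefix_entropy_def using h(2) by (rule convergentI)
  show "prefix_entropy X = top_entropy X"
    by (simp add: prefix_entropy_eqI[OF h(2)] top_entropy_eqI[OF h(1)])
next
  fix n :: nat and X :: "nat \<Rightarrow> (nat \<Rightarrow> 'a) set"
  assume n: "1 \<le> n"
    and X: "\<forall>i<n. X i \<subseteq> UNIV \<rightarrow> A \<and> X i \<noteq> {} \<and> weakly_shift_stable (X i)"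
  \<comment> \<open>Both limits are bundled in one predicate so that a single choice of
    \<open>h i\<close> serves blocks and prefixes alike.\<close>
  let ?rates = "\<lambda>i h. (\<lambda>k. 1 / real k * ln (real (card (blocks k (X i))))) \<longlonglongrightarrow> h
      \<and> (\<lambda>k. 1 / real k * ln (real (card (prefix_blocks k (X i))))) \<longlonglongrightarrow> h"
  have "\<exists>h. ?rates i h" if "i < n" for i
    by (rule weakly_shift_stable_rates[OF assms, of "X i"]) (use X that in auto)
  then have "\<forall>i\<in>{..<n}. \<exists>h. ?rates i h"
    by blast
  from bchoice[OF this] obtain h where rates: "\<forall>i\<in>{..<n}. ?rates i (h i)" ..
  have h: "(\<lambda>k. 1 / real k * ln (real (card (blocks k (X i))))) \<longlonglongrightarrow> h i"
    and hp: "(\<lambda>k. 1 / real k * ln (real (card (prefix_blocks k (X i))))) \<longlonglongrightarrow> h i"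
    if "i < n" for i
    using rates that by blast+
  have "top_entropy (interleaving n X) = ereal (1 / real n * (\<Sum>i<n. h i))"
    using X by (intro top_entropy_eqI interleaving_rate[OF assms n _ _ h hp]) auto
  \<comment> \<open>All component entropies are finite, so the extended-real sum and product agree
    with the real ones.\<close>
  also have "\<dots> = ereal (1 / real n) * (\<Sum>i<n. ereal (h i))"
    by simp
  also have "(\<Sum>i<n. ereal (h i)) = (\<Sum>i<n. top_entropy (X i))"
    by (intro sum.cong refl) (simp add: top_entropy_eqI[OF h])
  finally show "top_entropy (interleaving n X) = ereal (1 / real n) * (\<Sum>i<n. top_entropy (X i))" .
qed

end
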